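(* Let $(R,+,\cdot)$ be a commutative ring and let $A:R\to\mathbb{R}$ be an additive function. If at least one of the following conditions holds: (i) $A=0$ (i.e. $A$ is identically zero), (ii) $A(x^2)\geq 0$ for all $x\in R$, (iii) $A(x^2)\leq 0$ for all $x\in R$, then $A$ satisfies the inequality $$A(xy)^2\leq A(x^2)\,A(y^2)\qquad\text{for all } x,y\in R.$$ Conversely, if $R$ has a multiplicative unit element and $A$ satisfies $A(xy)^2\leq A(x^2)A(y^2)$ for all $x,y\in R$, then at least one of the conditions (i), (ii), (iii) holds.
   Context: Commutative rings are not assumed to have a multiplicative unit element unless stated. A function $A:R\to\mathbb{R}$ is additive if $A(x+y)=A(x)+A(y)$ for all $x,y\in R$. The product $x\cdot y$ is written $xy$, $x^2:=x\cdot x$, and $A(u)^2$ denotes $(A(u))^2$. *)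

theory Defs
  imports Complex_Main
begin

(* In a ring without a unit the library has no power operation, so x^2 is
   written x * x.  Commutativity makes the left unit below two-sided; e = 0 is
   allowed, so the zero ring counts as unital (unlike in comm_ring_1). *)
definition has_unit :: "'a::comm_ring itself \<Rightarrow> bool" where
  "has_unit _ \<longleftrightarrow> (\<exists>e::'a. \<forall>x. e * x = x)"

end

theory Submission
  imports Defs
begin

text \<open>
  The map \<open>(x, y) \<mapsto> A (x * y)\<close> is a symmetric biadditive form on \<open>R\<close>, so the inequality is the
  Cauchy--Schwarz inequality for this form.  If \<open>A\<close> is nonnegative on squares, the form is positive
  semidefinite, but \<open>R\<close> is only a module over the integers, so positivity on the span of \<open>x\<close>
  and \<open>y\<close> is known only for integer combinations.  This still bounds the discriminant, by
  lemma \<open>discriminant_le_if_nonneg_on_integers\<close>.  The case of nonpositive values on squares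
  follows by passing to \<open>- A\<close>.

  Conversely, with a unit \<open>e\<close>, the inequality for the pair \<open>x, e\<close> reads
  \<open>(A x)\<^sup>2 \<le> A (x * x) * A e\<close>.  Hence the sign of \<open>A e\<close> decides which condition holds: \<open>A (x * x)\<close>
  cannot have the sign opposite to \<open>A e\<close>, and \<open>A e = 0\<close> forces \<open>A = 0\<close>.
\<close>

text \<open>
  For \<open>c > 0\<close> the real quadratic \<open>a + 2 * t * b + t\<^sup>2 * c\<close> is minimal at \<open>t = - b / c\<close>, which integer
  pairs reach only approximately: for \<open>n > 0\<close> and \<open>m = \<lfloor>- (n * b / c)\<rfloor>\<close>, the ratio \<open>m / n\<close> is within
  \<open>1 / n\<close> of it.  The form at \<open>(n, m)\<close> is therefore at most \<open>n\<^sup>2 * (a - b\<^sup>2 / c) + c\<close>, which becomes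
  negative for large \<open>n\<close> unless \<open>b\<^sup>2 \<le> a * c\<close>.  For \<open>c = 0\<close> the form is linear in \<open>m\<close> at \<open>n = 1\<close>,
  so \<open>b\<close> must vanish.
\<close>
lemma discriminant_le_if_nonneg_on_integers:
  fixes a b c :: real
  assumes form: "\<And>n m :: int. 0 \<le> of_int n ^ 2 * a + 2 * of_int n * of_int m * b + of_int m ^ 2 * c"
  shows "b\<^sup>2 \<le> a * c"
proof -
  have "0 \<le> c"
    using form[of 0 1] by simp
  then consider "c = 0" | "0 < c"
    by linarith
  then show ?thesis
  proof cases
    case 1
    have "b = 0"
    proof (rule ccontr)
      assume "b \<noteq> 0"
      then obtain N :: nat where N: "a < real N * \<bar>b\<bar>"
        using ex_less_of_nat_mult[of "\<bar>b\<bar>" a] by auto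
      have "0 \<le> a + 2 * real N * b" "0 \<le> a - 2 * real N * b"
        using form[of 1 "int N"] form[of 1 "- int N"] 1 by simp_all
      then have "2 * (real N * \<bar>b\<bar>) \<le> a"
        by (cases "0 \<le> b") simp_all
      moreover have "0 \<le> real N * \<bar>b\<bar>"
        by simp
      ultimately show False
        using N by linarith
    qed
    then show ?thesis
      using 1 by simp
  next
    case 2
    show ?thesis
    proof (rule ccontr)
      assume "\<not> b\<^sup>2 \<le> a * c"
      then obtain N :: nat where N: "c\<^sup>2 < real N * (b\<^sup>2 - a * c)"
        using ex_less_of_nat_mult[of "b\<^sup>2 - a * c" "c\<^sup>2"] by auto
      define m where "m = \<lfloor>- (real N * b / c)\<rfloor>"
      \<comment> \<open>The rounding error, with values in \<open>(- 1, 0]\<close>; completing the square isolates it.\<close>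
      define r where "r = of_int m + real N * b / c"
      have "- 1 \<le> r" "r \<le> 0"
        unfolding r_def m_def by linarith+
      then have "r\<^sup>2 \<le> 1"
        using abs_square_le_1[of r] by linarith
      then have r: "c\<^sup>2 * r\<^sup>2 \<le> c\<^sup>2"
        by (simp add: mult_left_le)
      have m: "of_int m * c = r * c - real N * b"
        using 2 by (simp add: r_def field_simps)
      have "0 \<le> c * (real N ^ 2 * a + 2 * real N * of_int m * b + of_int m ^ 2 * c)"
        using form[of "int N" m] 2 by simp
      also have "\<dots> = real N ^ 2 * a * c + 2 * real N * b * (of_int m * c) + (of_int m * c)\<^sup>2"
        by (simp add: power2_eq_square algebra_simps)
      also have "\<dots> = c\<^sup>2 * r\<^sup>2 - real N ^ 2 * (b\<^sup>2 - a * c)"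
        unfolding m by (simp add: power2_eq_square algebra_simps)
      finally have "real N ^ 2 * (b\<^sup>2 - a * c) \<le> c\<^sup>2"
        using r by linarith
      moreover have "real N * (b\<^sup>2 - a * c) \<le> real N ^ 2 * (b\<^sup>2 - a * c)"
        using \<open>\<not> b\<^sup>2 \<le> a * c\<close> by (cases N) (auto intro!: mult_right_mono self_le_power)
      ultimately show False
        using N by linarith
    qed
  qed
qed

text \<open>
  A ring without a unit element has no elements that represent the integers, so \<open>k\<close> times \<open>x\<close> cannot
  be written as a product; it is an iterated sum, of which only the effect on the form matters.
\<close>
lemma additive_integer_multiple:
  fixes A :: "'a::comm_ring \<Rightarrow> real" and x :: 'a and k :: int
  assumes "additive A"
  obtains u where "\<And>z. A (u * z) = of_int k * A (x * z)"
proof -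
  have sum: "A ((\<Sum>i<n. x) * z) = real n * A (x * z)" for n :: nat and z
    by (simp add: sum_distrib_right additive.sum[OF assms])
  show ?thesis
  proof (cases k)
    case (nonneg n)
    show ?thesis
      by (rule that[of "\<Sum>i<n. x"]) (simp only: sum nonneg of_int_of_nat_eq)
  next
    case (neg n)
    show ?thesis
      by (rule that[of "- (\<Sum>i<Suc n. x)"])
        (simp only: sum neg mult_minus_left additive.minus[OF assms] of_int_minus
          of_int_of_nat_eq)
  qed
qed

lemma additive_Cauchy_Schwarz:
  fixes A :: "'a::comm_ring \<Rightarrow> real"
  assumes A: "additive A" and nonneg: "\<And>x. 0 \<le> A (x * x)"
  shows "(A (x * y))\<^sup>2 \<le> A (x * x) * A (y * y)"
proof (rule discriminant_le_if_nonneg_on_integers)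
  fix n m :: int
  obtain u where u: "\<And>z. A (u * z) = of_int n * A (x * z)"
    using additive_integer_multiple[OF A] by blast
  obtain v where v: "\<And>z. A (v * z) = of_int m * A (y * z)"
    using additive_integer_multiple[OF A] by blast
  have u': "A (z * u) = of_int n * A (z * x)" for z
    using u[of z] by (simp add: mult.commute)
  have v': "A (z * v) = of_int m * A (z * y)" for z
    using v[of z] by (simp add: mult.commute)
  have "0 \<le> A ((u + v) * (u + v))"
    by (rule nonneg)
  also have "\<dots> = A (u * u) + A (u * v) + A (v * u) + A (v * v)"
    by (simp add: additive.add[OF A] distrib_left distrib_right)
  also have "\<dots> = of_int n ^ 2 * A (x * x) + 2 * of_int n * of_int m * A (x * y)
      + of_int m ^ 2 * A (y * y)"
    unfolding u u' v v' by (simp add: power2_eq_square mult.commute[of y x])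
  finally show "0 \<le> of_int n ^ 2 * A (x * x) + 2 * of_int n * of_int m * A (x * y)
      + of_int m ^ 2 * A (y * y)" .
qed

theorem theorem2p2:
  fixes A :: "'a::comm_ring \<Rightarrow> real"
  assumes "additive A"
  shows "((\<forall>x. A x = 0) \<or> (\<forall>x. A (x * x) \<ge> 0) \<or> (\<forall>x. A (x * x) \<le> 0)
            \<longrightarrow> (\<forall>x y. (A (x * y))\<^sup>2 \<le> A (x * x) * A (y * y)))
       \<and> (has_unit TYPE('a) \<and> (\<forall>x y. (A (x * y))\<^sup>2 \<le> A (x * x) * A (y * y))
            \<longrightarrow> (\<forall>x. A x = 0) \<or> (\<forall>x. A (x * x) \<ge> 0) \<or> (\<forall>x. A (x * x) \<le> 0))"
proof (intro conjI impI)
  assume "(\<forall>x. A x = 0) \<or> (\<forall>x. A (x * x) \<ge> 0) \<or> (\<forall>x. A (x * x) \<le> 0)"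
  then consider "\<forall>x. A (x * x) \<ge> 0" | "\<forall>x. A (x * x) \<le> 0"
    by fastforce
  then show "\<forall>x y. (A (x * y))\<^sup>2 \<le> A (x * x) * A (y * y)"
  proof cases
    case 1
    then show ?thesis
      using additive_Cauchy_Schwarz[OF assms] by blast
  next
    case 2
    have "additive (\<lambda>x. - A x)"
      by (simp add: additive_def additive.add[OF assms])
    from additive_Cauchy_Schwarz[OF this] 2 show ?thesis
      by simp
  qed
next
  assume "has_unit TYPE('a) \<and> (\<forall>x y. (A (x * y))\<^sup>2 \<le> A (x * x) * A (y * y))"
  then obtain e :: 'a where e: "\<And>x. e * x = x"
    and ineq: "\<And>x y. (A (x * y))\<^sup>2 \<le> A (x * x) * A (y * y)"
    unfolding has_unit_def by blast
  have sq: "(A x)\<^sup>2 \<le> A e * A (x * x)" for x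
    using ineq[of e x] by (simp add: e)
  have prod: "0 \<le> A e * A (x * x)" for x
    using sq[of x] zero_le_power2[of "A x"] by linarith
  consider "A e = 0" | "0 < A e" | "A e < 0"
    by linarith
  then show "(\<forall>x. A x = 0) \<or> (\<forall>x. A (x * x) \<ge> 0) \<or> (\<forall>x. A (x * x) \<le> 0)"
  proof cases
    case 1
    then show ?thesis
      using sq by simp
  next
    case 2
    then show ?thesis
      using prod by (simp add: zero_le_mult_iff)
  next
    case 3
    then show ?thesis
      using prod by (simp add: zero_le_mult_iff)
  qed
qed

end
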